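(* Let $I\subset\mathbb{R}$ be an open interval, $n,q\in\mathbb{N}$, $\alpha,\beta\in\,]-1,+\infty[$. Let $f^\delta=f+\varpi$ be a noisy function on $I$, where $f\in C^{n+1+q}(I)$ satisfies $|f^{(n+1+q)}(x)|\le M_{n+1+q}$ for all $x\in I$ for some $M_{n+1+q}>0$, and $\varpi$ is a bounded and integrable noise with noise level $\delta=\sup_{x\in I}|\varpi(x)|$. Then, for $h>0$, $$\left\|D^{(n)}_{h,\alpha,\beta,q}f^{\delta}(x)-f^{(n)}(x)\right\|_\infty\le C_2h^{q+1}+C_3\frac{\delta}{h^{n}},$$ where $$C_2=\frac{M_{n+1+q}}{(n+1+q)!}\int_{-1}^{1}\left|t^{n+1+q}Q_{\alpha,\beta,n,q}(t)\right|dt,\qquad C_3=\int_{-1}^{1}\left|Q_{\alpha,\beta,n,q}(t)\right|dt.$$ Moreover, if (for $n\ge1$, $\delta>0$) we choose $h=\left[\frac{nC_3}{(q+1)C_2}\,\delta\right]^{\frac{1}{n+q+1}}$, then $$\left\|D^{(n)}_{h,\alpha,\beta,q}f^{\delta}(x)-f^{(n)}(x)\right\|_\infty=O\!\left(\delta^{\frac{q+1}{n+1+q}}\right)$$ (as $\delta\to0$, with constant independent of $\delta$).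
   Context: $\mathbb{N}$ includes $0$. For $h>0$, $I_h:=\{x\in I:\ [x-h,x+h]\subset I\}$, and $\|\cdot\|_\infty$ denotes the supremum over $x\in I_h$. For $\alpha,\beta>-1$: $P_n^{(\alpha,\beta)}(t)=\sum_{j=0}^{n}\binom{n+\alpha}{j}\binom{n+\beta}{n-j}\left(\frac{t-1}{2}\right)^{n-j}\left(\frac{t+1}{2}\right)^{j}$ is the $n$-th Jacobi polynomial, $w_{\alpha,\beta}(t)=(1-t)^{\alpha}(1+t)^{\beta}$, $B(a,b)=\Gamma(a)\Gamma(b)/\Gamma(a+b)$, $$\rho_{n,\alpha,\beta}(t)=\frac{2^{-(n+\alpha+\beta+1)}\,n!}{B(n+\alpha+1,n+\beta+1)}P_n^{(\alpha,\beta)}(t)\,w_{\alpha,\beta}(t),$$ $$Q_{\alpha,\beta,n,q}(t)=\sum_{i=0}^{q}P_i^{(\alpha+n,\beta+n)}(0)\sum_{j=0}^{i}(-1)^{i+j}\binom{i}{j}\frac{2i+\alpha+\beta+2n+1}{i+\alpha+\beta+2n+1}\,\rho_{n,\alpha_{i,j},\beta_j}(t),$$ with $\alpha_{i,j}=\alpha+i-j$, $\beta_j=\beta+j$; for $i=0$ the quotient is understood as $1$. The estimators applied to the noisy function are $$D^{(n)}_{h,\alpha,\beta,q}f^{\delta}(x)=\frac{1}{h^{n}}\int_{-1}^{1}Q_{\alpha,\beta,n,q}(t)\,f^{\delta}(x+ht)\,dt,\qquad x\in I_h.$$ *)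

theory Defs
  imports "HOL-Analysis.Analysis"
begin

definition jacobi_poly :: "nat \<Rightarrow> real \<Rightarrow> real \<Rightarrow> real \<Rightarrow> real" where
  "jacobi_poly n \<alpha> \<beta> t =
     (\<Sum>j=0..n. ((real n + \<alpha>) gchoose j) * ((real n + \<beta>) gchoose (n - j)) *
                ((t - 1) / 2) ^ (n - j) * ((t + 1) / 2) ^ j)"

text \<open>Only used on \<open>[-1, 1]\<close>. Since \<open>0 powr a = 0\<close>, the value at an endpoint differs from
  the usual one when the exponent is not positive, which does not affect any integral.\<close>

definition jacobi_weight :: "real \<Rightarrow> real \<Rightarrow> real \<Rightarrow> real" where
  "jacobi_weight \<alpha> \<beta> t = (1 - t) powr \<alpha> * (1 + t) powr \<beta>"

definition jacobi_rho :: "nat \<Rightarrow> real \<Rightarrow> real \<Rightarrow> real \<Rightarrow> real" where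
  "jacobi_rho n \<alpha> \<beta> t =
     2 powr (- (real n + \<alpha> + \<beta> + 1)) * fact n / Beta (real n + \<alpha> + 1) (real n + \<beta> + 1) *
     jacobi_poly n \<alpha> \<beta> t * jacobi_weight \<alpha> \<beta> t"

text \<open>For \<open>i = 0\<close> the quotient is set to 1 explicitly: its denominator vanishes there when
  \<open>n = 0\<close> and \<open>\<alpha> + \<beta> = -1\<close>.\<close>

definition Q_coeff :: "real \<Rightarrow> real \<Rightarrow> nat \<Rightarrow> nat \<Rightarrow> real" where
  "Q_coeff \<alpha> \<beta> n i =
     (if i = 0 then 1
      else (2 * real i + \<alpha> + \<beta> + 2 * real n + 1) / (real i + \<alpha> + \<beta> + 2 * real n + 1))"

definition Q_kernel :: "real \<Rightarrow> real \<Rightarrow> nat \<Rightarrow> nat \<Rightarrow> real \<Rightarrow> real" where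
  "Q_kernel \<alpha> \<beta> n q t =
     (\<Sum>i=0..q. jacobi_poly i (\<alpha> + real n) (\<beta> + real n) 0 *
        (\<Sum>j=0..i. (-1) ^ (i + j) * real (i choose j) * Q_coeff \<alpha> \<beta> n i *
                   jacobi_rho n (\<alpha> + real i - real j) (\<beta> + real j) t))"

text \<open>The noise is merely Lebesgue measurable, hence \<open>lebesgue\<close> rather than \<open>lborel\<close>.\<close>

definition deriv_estimator ::
  "nat \<Rightarrow> real \<Rightarrow> real \<Rightarrow> real \<Rightarrow> nat \<Rightarrow> (real \<Rightarrow> real) \<Rightarrow> real \<Rightarrow> real" where
  "deriv_estimator n h \<alpha> \<beta> q g x =
     1 / h ^ n * (LINT t:{-1..1}|lebesgue. Q_kernel \<alpha> \<beta> n q t * g (x + h * t))"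

definition inner_part :: "real set \<Rightarrow> real \<Rightarrow> real set" where
  "inner_part I h = {x \<in> I. {x - h..x + h} \<subseteq> I}"

text \<open>Valued in \<open>ennreal\<close>, so that it is a genuine supremum without a boundedness side condition,
  and it is 0 on the empty set.\<close>

definition sup_norm_on :: "real set \<Rightarrow> (real \<Rightarrow> real) \<Rightarrow> ennreal" where
  "sup_norm_on A g = (SUP x\<in>A. ennreal \<bar>g x\<bar>)"

text \<open>Only meaningful for open \<open>S\<close>, since \<open>deriv\<close> is the two-sided derivative.\<close>

definition Ck_on :: "nat \<Rightarrow> (real \<Rightarrow> real) \<Rightarrow> real set \<Rightarrow> bool" where
  "Ck_on k f S \<longleftrightarrow>
     (\<forall>j<k. (deriv ^^ j) f differentiable_on S) \<and> continuous_on S ((deriv ^^ k) f)"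

definition noise_on :: "real set \<Rightarrow> (real \<Rightarrow> real) \<Rightarrow> bool" where
  "noise_on I \<omega> \<longleftrightarrow> bounded (\<omega> ` I) \<and> \<omega> absolutely_integrable_on I"

definition noise_level :: "real set \<Rightarrow> (real \<Rightarrow> real) \<Rightarrow> real" where
  "noise_level I \<omega> = (SUP x\<in>I. \<bar>\<omega> x\<bar>)"

definition C2 :: "real \<Rightarrow> real \<Rightarrow> real \<Rightarrow> nat \<Rightarrow> nat \<Rightarrow> real" where
  "C2 M \<alpha> \<beta> n q =
     M / fact (n + 1 + q) * (LINT t:{-1..1}|lebesgue. \<bar>t ^ (n + 1 + q) * Q_kernel \<alpha> \<beta> n q t\<bar>)"

definition C3 :: "real \<Rightarrow> real \<Rightarrow> nat \<Rightarrow> nat \<Rightarrow> real" where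
  "C3 \<alpha> \<beta> n q = (LINT t:{-1..1}|lebesgue. \<bar>Q_kernel \<alpha> \<beta> n q t\<bar>)"

definition h_choice :: "real \<Rightarrow> real \<Rightarrow> real \<Rightarrow> nat \<Rightarrow> nat \<Rightarrow> real \<Rightarrow> real" where
  "h_choice M \<alpha> \<beta> n q \<delta> =
     (real n * C3 \<alpha> \<beta> n q / ((real q + 1) * C2 M \<alpha> \<beta> n q) * \<delta>) powr (1 / (real n + real q + 1))"

end

theory Submission
  imports Defs
begin

text \<open>The kernel $Q$ is built so that integrating it against a polynomial of degree at most $n + q$
  returns the $n$-th derivative of that polynomial at $0$ without error. Once this is known
  (\<open>Q_kernel_has_integral\<close>), the error bound is Taylor's theorem: the Taylor polynomial of
  $t \mapsto f(x + ht)$ of degree $n + q$ contributes exactly $h^n f^{(n)}(x)$, its remainder is at most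
  $M h^{n+1+q} |t|^{n+1+q} / (n+1+q)!$, and the noise is at most $\delta$; integrating both against
  $|Q|$ gives the two terms (\<open>estimator_error_bound\<close>).

  The exactness of $Q$ rests on differencing in the parameters of the weight. Write
  $E_{a,b}$ for the mean with respect to the weight $w_{a,b}$ normalised to a probability density. One integration by parts turns $E_{a+1,b+1}[g']$ into a multiple of the difference
  $E_{a,b+1}[g] - E_{a+1,b}[g]$, so $E_{a+n,b+n}[g^{(n)}]$ is an $n$-fold finite difference of
  means in the parameters. The Beta function cancels against the binomial coefficients in $P_n^{(a,b)}$,
  and \<open>jacobi_rho_eq_sum\<close> shows that $\rho_{n,a,b}$ is the same
  finite difference of densities. Hence $\int \rho_{n,a,b}\, g = E_{a+n,b+n}[g^{(n)}]$, and the alternating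
  sum over $j$ in $Q$ is, up to a factor, an $i$-fold derivative in disguise.

  What remains is the expansion $g(x) = \sum_i \kappa_i P_i^{(a,b)}(x) E_{a+i,b+i}[g^{(i)}]$ for
  polynomials (\<open>jacobi_expansion\<close>). The factors $\kappa_i$ make $\kappa_i P_i^{(a,b)}$ an Appell-like
  family: its derivative is the member of index $i - 1$ with both parameters raised by one. So both sides have
  the same derivative by induction on the degree, and the same mean under $E_{a,b}$
  because $P_i^{(a,b)}$ has mean zero for $i > 0$. At $x = 0$ this is the exactness of $Q$.

  For the rate, $C_2$ and $C_3$ must be positive. They are, because an almost everywhere vanishing
  $Q$ could not have the $n$-th moment $n!$. The chosen step then makes both terms multiples
  of the same power of $\delta$.\<close>

section \<open>Means with respect to normalised Jacobi weights\<close>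

definition jacobi_density :: "real \<Rightarrow> real \<Rightarrow> real \<Rightarrow> real" where
  "jacobi_density a b t = jacobi_weight a b t / (2 powr (a + b + 1) * Beta (a + 1) (b + 1))"

definition jacobi_mean :: "real \<Rightarrow> real \<Rightarrow> (real \<Rightarrow> real) \<Rightarrow> real" where
  "jacobi_mean a b g = integral {-1..1} (\<lambda>t. jacobi_density a b t * g t)"

lemma Beta_pos: "0 < Beta x y" if "0 < x" "0 < y" for x y :: real
  using that by (simp add: Beta_def)

lemma jacobi_density_has_integral:
  assumes "a > -1" "b > -1"
  shows "(jacobi_density a b has_integral 1) {-1..1}"
proof -
  define N where "N = 2 powr (a + b + 1) * Beta (a + 1) (b + 1)"
  have "N > 0" using assms by (simp add: N_def Beta_pos)
  have "((\<lambda>u. u powr b * (1 - u) powr a) has_integral Beta (b + 1) (a + 1)) (cbox 0 1)"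
    using has_integral_Beta_real[of "b + 1" "a + 1"] assms by simp
  from has_integral_affinity'[OF this, of "1/2" "1/2"]
  have "((\<lambda>t. (t/2 + 1/2) powr b * (1 - (t/2 + 1/2)) powr a) has_integral
      2 * Beta (b + 1) (a + 1)) {-1..1}" by simp
  from has_integral_mult_right[OF this, of "2 powr (a + b) / N"]
  have "((\<lambda>t. 2 powr (a + b) / N * ((t/2 + 1/2) powr b * (1 - (t/2 + 1/2)) powr a)) has_integral
      2 powr (a + b) / N * (2 * Beta (b + 1) (a + 1))) {-1..1}" .
  also have "2 powr (a + b) / N * (2 * Beta (b + 1) (a + 1)) = 1"
    using Beta_pos[of "a + 1" "b + 1"] assms by (simp add: N_def powr_add Beta_commute)
  finally have int: "((\<lambda>t. 2 powr (a + b) / N * ((t/2 + 1/2) powr b * (1 - (t/2 + 1/2)) powr a))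
      has_integral 1) {-1..1}" .
  have "2 powr (a + b) / N * ((t/2 + 1/2) powr b * (1 - (t/2 + 1/2)) powr a)
      = jacobi_density a b t" if "t \<in> {-1..1}" for t
  proof -
    have "(t/2 + 1/2) powr b = (1 + t) powr b / 2 powr b"
      using that by (subst powr_divide[symmetric]) (auto simp: field_simps)
    moreover have "(1 - (t/2 + 1/2)) powr a = (1 - t) powr a / 2 powr a"
      using that by (subst powr_divide[symmetric]) (auto simp: field_simps)
    ultimately show ?thesis
      by (simp add: jacobi_density_def jacobi_weight_def N_def powr_add mult_ac)
  qed
  then show ?thesis
    using has_integral_eq[OF _ int] by blast
qed

lemma jacobi_density_nonneg:
  "a > -1 \<Longrightarrow> b > -1 \<Longrightarrow> jacobi_density a b t \<ge> 0"
  by (simp add: jacobi_density_def jacobi_weight_def Beta_pos less_imp_le)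

lemma jacobi_density_absolutely_integrable:
  assumes "a > -1" "b > -1"
  shows "jacobi_density a b absolutely_integrable_on {-1..1}"
  using jacobi_density_has_integral[OF assms] jacobi_density_nonneg[OF assms]
  by (intro nonnegative_absolutely_integrable_1) auto

lemma absolutely_integrable_mult_continuous:
  fixes k g :: "real \<Rightarrow> real"
  assumes "k absolutely_integrable_on {c..d}" and "continuous_on {c..d} g"
  shows "(\<lambda>t. k t * g t) absolutely_integrable_on {c..d}"
proof -
  have "g \<in> borel_measurable (lebesgue_on {c..d})"
    by (intro continuous_imp_measurable_on_sets_lebesgue assms) auto
  moreover have "bounded (g ` {c..d})"
    by (intro compact_imp_bounded compact_continuous_image assms) auto
  ultimately have "(\<lambda>t. g t * k t) absolutely_integrable_on {c..d}"
    using assms by (intro absolutely_integrable_bounded_measurable_product_real) auto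
  then show ?thesis by (simp add: mult.commute)
qed

lemma jacobi_mean_has_integral:
  assumes "a > -1" "b > -1" "continuous_on {-1..1} g"
  shows "((\<lambda>t. jacobi_density a b t * g t) has_integral jacobi_mean a b g) {-1..1}"
  unfolding jacobi_mean_def
  using absolutely_integrable_mult_continuous[OF jacobi_density_absolutely_integrable[OF assms(1,2)] assms(3)]
  by (intro integrable_integral) (simp add: absolutely_integrable_on_def)

lemma jacobi_mean_const: "a > -1 \<Longrightarrow> b > -1 \<Longrightarrow> jacobi_mean a b (\<lambda>_. c) = c"
  unfolding jacobi_mean_def
  using has_integral_mult_left[OF jacobi_density_has_integral, of a b c]
  by (intro integral_unique) simp


section \<open>Finite differences of means as means of derivatives\<close>

text \<open>Raising a parameter by one changes the normalising Beta factor rationally. This puts the two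
  terms of the derivative of the weight over a common denominator, with the same coefficient in front of both densities.\<close>

lemma jacobi_density_norm_shift:
  assumes "a > -1" "b > -1"
  shows "(a + b + 3) / 2 * jacobi_density (a + 1) b t =
      (b + 1) * jacobi_weight (a + 1) b t / (2 powr (a + b + 3) * Beta (a + 2) (b + 2))"
    and "(a + b + 3) / 2 * jacobi_density a (b + 1) t =
      (a + 1) * jacobi_weight a (b + 1) t / (2 powr (a + b + 3) * Beta (a + 2) (b + 2))"
proof -
  have pw: "2 powr (a + b + 3) = 2 * 2 powr (a + b + 2)"
    by (simp add: powr_add)
  have "(a + b + 3) * Beta (a + 2) (b + 2) = (b + 1) * Beta (a + 2) (b + 1)"
    using Beta_plus1_right[of "b + 1" "a + 2"] assms
    by (simp add: nonpos_Ints_def algebra_simps)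
  then have "Beta (a + 2) (b + 2) = (b + 1) * Beta (a + 2) (b + 1) / (a + b + 3)"
    using assms by (simp add: field_simps)
  then show "(a + b + 3) / 2 * jacobi_density (a + 1) b t =
      (b + 1) * jacobi_weight (a + 1) b t / (2 powr (a + b + 3) * Beta (a + 2) (b + 2))"
    using assms by (simp add: jacobi_density_def pw add.commute add.left_commute)
  have "(a + b + 3) * Beta (a + 2) (b + 2) = (a + 1) * Beta (a + 1) (b + 2)"
    using Beta_plus1_left[of "a + 1" "b + 2"] assms
    by (simp add: nonpos_Ints_def algebra_simps)
  then have "Beta (a + 2) (b + 2) = (a + 1) * Beta (a + 1) (b + 2) / (a + b + 3)"
    using assms by (simp add: field_simps)
  then show "(a + b + 3) / 2 * jacobi_density a (b + 1) t =
      (a + 1) * jacobi_weight a (b + 1) t / (2 powr (a + b + 3) * Beta (a + 2) (b + 2))"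
    using assms by (simp add: jacobi_density_def pw add.commute add.left_commute)
qed

lemma jacobi_density_has_derivative:
  assumes "a > -1" "b > -1" "t \<in> {-1<..<1}"
  shows "(jacobi_density (a + 1) (b + 1) has_real_derivative
    (a + b + 3) / 2 * jacobi_density (a + 1) b t - (a + b + 3) / 2 * jacobi_density a (b + 1) t) (at t)"
proof -
  define N where "N = 2 powr (a + b + 3) * Beta (a + 2) (b + 2)"
  have "((\<lambda>t. (1 - t) powr (a + 1) * (1 + t) powr (b + 1)) has_real_derivative
     (b + 1) * jacobi_weight (a + 1) b t - (a + 1) * jacobi_weight a (b + 1) t) (at t)"
  proof -
    have "((\<lambda>t. (1 - t) powr (a + 1)) has_real_derivative (a + 1) * (1 - t) powr (a + 1 - of_nat 1) * (- 1)) (at t)"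
      using assms(3) by (intro DERIV_fun_powr) (auto intro!: derivative_eq_intros)
    moreover have "((\<lambda>t. (1 + t) powr (b + 1)) has_real_derivative (b + 1) * (1 + t) powr (b + 1 - of_nat 1) * 1) (at t)"
      using assms(3) by (intro DERIV_fun_powr) (auto intro!: derivative_eq_intros)
    ultimately have "((\<lambda>t. (1 - t) powr (a + 1) * (1 + t) powr (b + 1)) has_real_derivative
       (a + 1) * (1 - t) powr (a + 1 - of_nat 1) * (- 1) * (1 + t) powr (b + 1) +
       (b + 1) * (1 + t) powr (b + 1 - of_nat 1) * 1 * (1 - t) powr (a + 1)) (at t)"
      by (rule DERIV_mult)
    then show ?thesis
      by (rule back_subst[of "\<lambda>x. (_ has_real_derivative x) _"]) (simp add: jacobi_weight_def)
  qed
  from DERIV_cdivide[OF this, of N]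
  show ?thesis
    unfolding jacobi_density_norm_shift[OF assms(1,2)] N_def
    by (simp add: jacobi_density_def[abs_def] jacobi_weight_def diff_divide_distrib add_ac)
qed

lemma continuous_on_jacobi_density:
  assumes "a > 0" "b > 0"
  shows "continuous_on {-1..1} (jacobi_density a b)"
  unfolding jacobi_density_def[abs_def] jacobi_weight_def divide_inverse
  by (intro continuous_intros continuous_on_powr') (use assms in auto)

text \<open>Both parameters on the left exceed $0$, so the density on the left vanishes at $\pm 1$ and integration by
  parts leaves no boundary term. The densities on the right may be unbounded at the end points, where
  the density on the left is continuous but need not be differentiable.\<close>

lemma jacobi_mean_by_parts:
  assumes "a > -1" "b > -1"
    and deriv: "\<And>t. (g has_real_derivative g' t) (at t)" and cont: "continuous_on {-1..1} g'"
  shows "jacobi_mean (a + 1) (b + 1) g' =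
    (a + b + 3) / 2 * (jacobi_mean a (b + 1) g - jacobi_mean (a + 1) b g)"
proof -
  let ?d = "jacobi_density (a + 1) (b + 1)"
  let ?F' = "\<lambda>t. ((a + b + 3) / 2 * (jacobi_density (a + 1) b t * g t)
      - (a + b + 3) / 2 * (jacobi_density a (b + 1) t * g t)) + ?d t * g' t"
  have g: "continuous_on {-1..1} g"
    using deriv by (meson DERIV_isCont continuous_at_imp_continuous_on)
  have "(?F' has_integral ?d 1 * g 1 - ?d (-1) * g (-1)) {-1..1}"
  proof (rule fundamental_theorem_of_calculus_interior)
    show "continuous_on {-1..1} (\<lambda>t. ?d t * g t)"
      by (intro continuous_intros continuous_on_jacobi_density g) (use assms in auto)
    fix t :: real assume "t \<in> {-1<..<1}"
    from DERIV_mult[OF jacobi_density_has_derivative[OF assms(1,2) this] deriv]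
    show "((\<lambda>t. ?d t * g t) has_vector_derivative ?F' t) (at t)"
      unfolding has_real_derivative_iff_has_vector_derivative[symmetric]
      by (rule back_subst[of "\<lambda>x. (_ has_real_derivative x) _"]) (simp add: left_diff_distrib)
  qed auto
  moreover have "(?F' has_integral ((a + b + 3) / 2 * jacobi_mean (a + 1) b g
      - (a + b + 3) / 2 * jacobi_mean a (b + 1) g) + jacobi_mean (a + 1) (b + 1) g') {-1..1}"
    by (intro has_integral_add has_integral_diff has_integral_mult_right jacobi_mean_has_integral)
       (use assms g in auto)
  ultimately have "?d 1 * g 1 - ?d (-1) * g (-1) = ((a + b + 3) / 2 * jacobi_mean (a + 1) b g
      - (a + b + 3) / 2 * jacobi_mean a (b + 1) g) + jacobi_mean (a + 1) (b + 1) g'"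
    by (rule has_integral_unique)
  moreover have "?d 1 = 0" "?d (-1) = 0"
    by (simp_all add: jacobi_density_def jacobi_weight_def)
  ultimately show ?thesis by (simp add: right_diff_distrib)
qed

text \<open>Pascal's rule for iterated forward differences: the difference of order $n + 1$ of $F$ is the
  difference of order $n$ of the forward difference of $F$.\<close>

lemma alternating_binomial_sum_Suc:
  fixes F :: "nat \<Rightarrow> 'a :: comm_ring_1"
  shows "(\<Sum>j\<le>Suc n. (-1) ^ (Suc n + j) * of_nat (Suc n choose j) * F j) =
    (\<Sum>j\<le>n. (-1) ^ (n + j) * of_nat (n choose j) * (F (Suc j) - F j))"
proof -
  let ?s = "\<lambda>j. (-1) ^ (n + j) * of_nat (n choose j) * F j"
  have "(\<Sum>j\<le>n. (-1) ^ (n + j) * of_nat (n choose Suc j) * F (Suc j)) =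
      - (\<Sum>j\<le>n. ?s (Suc j))"
    by (simp add: sum_negf)
  also have "(\<Sum>j\<le>n. ?s (Suc j)) = (\<Sum>j\<le>Suc n. ?s j) - ?s 0"
    by (simp only: sum.atMost_Suc_shift) simp
  also have "(\<Sum>j\<le>Suc n. ?s j) = (\<Sum>j\<le>n. ?s j)"
    by (simp add: binomial_eq_0)
  finally have *: "(\<Sum>j\<le>n. (-1) ^ (n + j) * of_nat (n choose Suc j) * F (Suc j)) =
      (-1) ^ n * F 0 - (\<Sum>j\<le>n. ?s j)" by simp
  have "(\<Sum>j\<le>Suc n. (-1) ^ (Suc n + j) * of_nat (Suc n choose j) * F j) =
      - ((-1) ^ n * F 0) + ((\<Sum>j\<le>n. (-1) ^ (n + j) * of_nat (n choose j) * F (Suc j))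
        + (\<Sum>j\<le>n. (-1) ^ (n + j) * of_nat (n choose Suc j) * F (Suc j)))"
    by (subst sum.atMost_Suc_shift) (simp add: sum.distrib[symmetric] algebra_simps)
  then show ?thesis
    unfolding * by (simp add: algebra_simps sum_subtractf)
qed

text \<open>Each integration by parts lowers one of the two parameters, so $n$ of them give an alternating
  binomial sum over how often each parameter was chosen.\<close>

lemma jacobi_mean_higher_pderiv:
  assumes "a > -1" "b > -1"
  shows "jacobi_mean (a + real n) (b + real n) (poly ((pderiv ^^ n) p)) =
    pochhammer (a + b + real n + 2) n / 2 ^ n *
      (\<Sum>j\<le>n. (-1) ^ (n + j) * real (n choose j) *
        jacobi_mean (a + real n - real j) (b + real j) (poly p))"
  using assms
proof (induction n arbitrary: a b p)
  case 0
  then show ?case by simp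
next
  case (Suc n)
  let ?F = "\<lambda>j. jacobi_mean (a + real (Suc n) - real j) (b + real j) (poly p)"
  have parts: "jacobi_mean (a + 1 + real n - real j) (b + 1 + real j) (poly (pderiv p)) =
      (a + b + real n + 3) / 2 * (?F (Suc j) - ?F j)" if "j \<le> n" for j
  proof -
    have "a + real n - real j + 1 = a + 1 + real n - real j"
      "b + real j + 1 = b + 1 + real j" "a + real n - real j + (b + real j) + 3 = a + b + real n + 3"
      "a + real (Suc n) - real (Suc j) = a + real n - real j"
      "a + real (Suc n) - real j = a + 1 + real n - real j"
      "b + real (Suc j) = b + 1 + real j"
      by simp_all
    then show ?thesis
      using jacobi_mean_by_parts[of "a + real n - real j" "b + real j" "poly p" "poly (pderiv p)"] Suc.prems that
      by (simp only: poly_DERIV continuous_on_poly continuous_on_id)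
  qed
  have "jacobi_mean (a + real (Suc n)) (b + real (Suc n)) (poly ((pderiv ^^ Suc n) p)) =
      jacobi_mean (a + 1 + real n) (b + 1 + real n) (poly ((pderiv ^^ n) (pderiv p)))"
    by (simp add: funpow_swap1 add.assoc)
  also have "\<dots> = pochhammer (a + 1 + (b + 1) + real n + 2) n / 2 ^ n *
      (\<Sum>j\<le>n. (-1) ^ (n + j) * real (n choose j) *
        jacobi_mean (a + 1 + real n - real j) (b + 1 + real j) (poly (pderiv p)))"
    using Suc.prems by (intro Suc.IH) auto
  also have "(\<Sum>j\<le>n. (-1) ^ (n + j) * real (n choose j) *
        jacobi_mean (a + 1 + real n - real j) (b + 1 + real j) (poly (pderiv p))) =
      (a + b + real n + 3) / 2 * (\<Sum>j\<le>n. (-1) ^ (n + j) * real (n choose j) * (?F (Suc j) - ?F j))"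
    unfolding sum_distrib_left by (intro sum.cong refl) (simp add: parts)
  also have "(\<Sum>j\<le>n. (-1) ^ (n + j) * real (n choose j) * (?F (Suc j) - ?F j)) =
      (\<Sum>j\<le>Suc n. (-1) ^ (Suc n + j) * real (Suc n choose j) * ?F j)"
    by (rule alternating_binomial_sum_Suc[symmetric])
  also have "pochhammer (a + 1 + (b + 1) + real n + 2) n / 2 ^ n * ((a + b + real n + 3) / 2 * S) =
      pochhammer (a + b + real (Suc n) + 2) (Suc n) / 2 ^ Suc n * S" for S
    by (simp add: pochhammer_rec add_ac mult_ac)
  finally show ?case .
qed

section \<open>The kernels rho as differences of densities\<close>

text \<open>The Gamma factors in the denominators of the generalised binomials are those in the numerator of
  the Beta function, so only the ordinary binomial coefficient depends on $j$.\<close>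

lemma gbinomial_mult_Beta:
  fixes a b :: real
  assumes "a > -1" "b > -1" "j \<le> n"
  shows "((real n + a) gchoose j) * ((real n + b) gchoose (n - j)) *
      Beta (a + real n - real j + 1) (b + real j + 1) =
    real (n choose j) / fact n * (Gamma (real n + a + 1) * Gamma (real n + b + 1) / Gamma (a + b + real n + 2))"
proof -
  have *: "((real n + a) gchoose j) = Gamma (real n + a + 1) / (fact j * Gamma (a + real n - real j + 1))"
    by (subst gbinomial_Gamma) (use assms in \<open>auto simp: nonpos_Ints_def add_ac\<close>)
  have **: "((real n + b) gchoose (n - j)) =
      Gamma (real n + b + 1) / (fact (n - j) * Gamma (b + real j + 1))"
    by (subst gbinomial_Gamma) (use assms in \<open>auto simp: nonpos_Ints_def add_ac of_nat_diff\<close>)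
  have "Gamma (a + real n - real j + 1) > 0" "Gamma (b + real j + 1) > 0"
    using assms by auto
  then have nz: "Gamma (a + real n - real j + 1) \<noteq> 0" "Gamma (b + real j + 1) \<noteq> 0"
    by linarith+
  have "X \<noteq> 0 \<Longrightarrow> Y \<noteq> 0 \<Longrightarrow> P / (fact j * X) * (R / (fact (n - j) * Y)) * (X * Y / Z) =
      1 / (fact j * fact (n - j)) * (P * R / Z)" for P R X Y Z :: real
    by simp
  note cancel = this[OF nz]
  have "a + real n - real j + 1 + (b + real j + 1) = a + b + real n + 2" by simp
  moreover have "real (n choose j) / fact n = 1 / (fact j * fact (n - j))"
    using assms(3) by (simp add: binomial_fact)
  ultimately show ?thesis
    unfolding * ** Beta_def by (simp only: cancel)
qed

text \<open>Absorbing the powers of $1 - t$ and $1 + t$ in $P_n^{(a,b)}$ into the weight shifts its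
  parameters. By \<open>gbinomial_mult_Beta\<close> the coefficients become those of
  \<open>jacobi_mean_higher_pderiv\<close>. This is Rodrigues' formula with the derivative of the weight written as a
  finite difference in its parameters.\<close>

lemma jacobi_rho_eq_sum:
  assumes "a > -1" "b > -1" "t \<in> {-1..1}"
  shows "jacobi_rho n a b t = pochhammer (a + b + real n + 2) n / 2 ^ n *
    (\<Sum>j\<le>n. (-1) ^ (n + j) * real (n choose j) * jacobi_density (a + real n - real j) (b + real j) t)"
proof -
  let ?G = "Gamma (real n + a + 1) * Gamma (real n + b + 1) / Gamma (a + b + real n + 2)"
  define c where "c = 2 powr (real n + a + b + 1)"
  have "c > 0" by (simp add: c_def)
  have summand: "((real n + a) gchoose j) * ((real n + b) gchoose (n - j)) *
      ((t - 1) / 2) ^ (n - j) * ((t + 1) / 2) ^ j * jacobi_weight a b t =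
      c * ?G / (fact n * 2 ^ n) *
        ((-1) ^ (n + j) * real (n choose j) * jacobi_density (a + real n - real j) (b + real j) t)"
    if "j \<le> n" for j
  proof -
    let ?B = "Beta (a + real n - real j + 1) (b + real j + 1)"
    have "?B > 0" using assms that by (intro Beta_pos) auto
    \<comment> \<open>At the end points both sides are zero, since \<open>0 powr x = 0\<close> for every \<open>x\<close>.\<close>
    have 1: "(1 - t) ^ (n - j) * (1 - t) powr a = (1 - t) powr (a + real n - real j)"
    proof (cases "t = 1")
      case False
      then show ?thesis using assms(3) that
        by (subst powr_realpow[symmetric]) (auto simp: powr_add[symmetric] of_nat_diff algebra_simps)
    qed simp
    have 2: "(1 + t) ^ j * (1 + t) powr b = (1 + t) powr (b + real j)"
    proof (cases "t = -1")
      case False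
      then show ?thesis using assms(3)
        by (subst powr_realpow[symmetric]) (auto simp: powr_add[symmetric] algebra_simps)
    qed simp
    have "((t - 1) / 2) ^ (n - j) = (-1) ^ (n - j) * (1 - t) ^ (n - j) / 2 ^ (n - j)"
      by (simp add: power_mult_distrib[symmetric] power_divide)
    also have "(-1 :: real) ^ (n - j) = (-1) ^ (n + j)"
      using that by (simp add: minus_one_power_iff)
    finally have "((t - 1) / 2) ^ (n - j) * ((t + 1) / 2) ^ j * jacobi_weight a b t =
        (-1) ^ (n + j) / (2 ^ (n - j) * 2 ^ j) * (((1 - t) ^ (n - j) * (1 - t) powr a)
         * ((1 + t) ^ j * (1 + t) powr b))"
      by (simp add: jacobi_weight_def power_divide add.commute)
    also have "\<dots> = (-1) ^ (n + j) / 2 ^ n * jacobi_weight (a + real n - real j) (b + real j) t"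
      using that by (simp add: 1 2 jacobi_weight_def power_add[symmetric])
    also have "jacobi_weight (a + real n - real j) (b + real j) t =
        c * ?B * jacobi_density (a + real n - real j) (b + real j) t"
      using \<open>?B > 0\<close> \<open>c > 0\<close> by (simp add: jacobi_density_def c_def add_ac)
    finally have "((real n + a) gchoose j) * ((real n + b) gchoose (n - j)) *
      (((t - 1) / 2) ^ (n - j) * ((t + 1) / 2) ^ j * jacobi_weight a b t) =
      (-1) ^ (n + j) / 2 ^ n * c * (((real n + a) gchoose j) * ((real n + b) gchoose (n - j)) * ?B)
        * jacobi_density (a + real n - real j) (b + real j) t"
      by (simp add: mult_ac)
    then show ?thesis
      unfolding gbinomial_mult_Beta[OF assms(1,2) that] by (simp add: mult_ac)
  qed
  have 1: "jacobi_poly n a b t * jacobi_weight a b t = c * ?G / (fact n * 2 ^ n) *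
     (\<Sum>j\<le>n. (-1) ^ (n + j) * real (n choose j) * jacobi_density (a + real n - real j) (b + real j) t)"
    unfolding jacobi_poly_def sum_distrib_right sum_distrib_left atLeast0AtMost
    by (intro sum.cong refl summand) auto
  have 2: "2 powr (- (real n + a + b + 1)) * c = 1"
    by (simp add: c_def powr_add[symmetric])
  have 3: "?G / Beta (real n + a + 1) (real n + b + 1) = pochhammer (a + b + real n + 2) n"
  proof -
    have "pochhammer (a + b + real n + 2) n = Gamma (a + b + real n + 2 + real n) / Gamma (a + b + real n + 2)"
      if "n > 0" using that assms by (intro pochhammer_Gamma) (auto simp: nonpos_Ints_def)
    moreover have "Gamma (real n + a + 1) > 0" "Gamma (real n + b + 1) > 0" "Gamma (a + b + real n + 2) > 0"
      using assms by auto
    ultimately show ?thesis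
      by (cases "n = 0") (auto simp: Beta_def add_ac)
  qed
  have 4: "jacobi_rho n a b t = 2 powr (- (real n + a + b + 1)) * fact n /
      Beta (real n + a + 1) (real n + b + 1) * (jacobi_poly n a b t * jacobi_weight a b t)"
    by (simp add: jacobi_rho_def)
  have 5: "p * fact n / B * (c * G / (fact n * 2 ^ n) * S) = (p * c) * (G / B) / 2 ^ n * S"
    for p B G S :: real by simp
  show ?thesis
    unfolding 4 1 5 2 3 by simp
qed

lemma jacobi_rho_absolutely_integrable:
  assumes "a > -1" "b > -1"
  shows "jacobi_rho n a b absolutely_integrable_on {-1..1}"
proof -
  have "(\<lambda>t. pochhammer (a + b + real n + 2) n / 2 ^ n *
    (\<Sum>j\<le>n. (-1) ^ (n + j) * real (n choose j) * jacobi_density (a + real n - real j) (b + real j) t))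
    absolutely_integrable_on {-1..1}"
    by (intro set_integrable_mult_right absolutely_integrable_sum jacobi_density_absolutely_integrable)
       (use assms in auto)
  then show ?thesis
    by (rule set_integrable_cong[THEN iffD1, rotated -1]) (use assms in \<open>auto simp: jacobi_rho_eq_sum\<close>)
qed

lemma jacobi_rho_has_integral:
  assumes "a > -1" "b > -1"
  shows "((\<lambda>t. jacobi_rho n a b t * poly p t) has_integral
    jacobi_mean (a + real n) (b + real n) (poly ((pderiv ^^ n) p))) {-1..1}"
proof -
  have "((\<lambda>t. pochhammer (a + b + real n + 2) n / 2 ^ n *
      (\<Sum>j\<le>n. (-1) ^ (n + j) * real (n choose j) *
        (jacobi_density (a + real n - real j) (b + real j) t * poly p t)))
    has_integral
    pochhammer (a + b + real n + 2) n / 2 ^ n *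
      (\<Sum>j\<le>n. (-1) ^ (n + j) * real (n choose j) *
        jacobi_mean (a + real n - real j) (b + real j) (poly p))) {-1..1}"
    by (intro has_integral_mult_right has_integral_sum jacobi_mean_has_integral continuous_intros)
       (use assms in auto)
  then show ?thesis
    unfolding jacobi_mean_higher_pderiv[OF assms]
    by (rule has_integral_cong[THEN iffD1, rotated])
       (use assms in \<open>simp add: jacobi_rho_eq_sum sum_distrib_right mult.assoc\<close>)
qed

section \<open>Expansion of polynomials in Jacobi polynomials\<close>

text \<open>The density times $P_n^{(a,b)}$ is a multiple of $\rho_{n,a,b}$, whose integral is the mean of
  the $n$-th derivative of the constant $1$.\<close>

lemma jacobi_mean_jacobi_poly:
  assumes "a > -1" "b > -1" "n > 0"
  shows "jacobi_mean a b (jacobi_poly n a b) = 0"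
proof -
  define c where "c = 2 powr (- (real n + a + b + 1)) * fact n / Beta (real n + a + 1) (real n + b + 1)
    * (2 powr (a + b + 1) * Beta (a + 1) (b + 1))"
  have pos: "Beta (real n + a + 1) (real n + b + 1) > 0" "Beta (a + 1) (b + 1) > 0"
    using assms by (auto intro: Beta_pos)
  then have "c > 0" by (simp add: c_def)
  have "(pderiv ^^ n) (1 :: real poly) = 0"
    using assms(3) by (cases n) (simp_all add: funpow_swap1 pderiv_1)
  then have "((\<lambda>t. jacobi_rho n a b t * poly 1 t) has_integral 0) {-1..1}"
    using jacobi_rho_has_integral[OF assms(1,2), of n 1] jacobi_mean_const[of "a + n" "b + n" 0] assms
    by (simp add: poly_0[abs_def])
  from has_integral_mult_right[OF this, of "1 / c"]
  have "((\<lambda>t. 1 / c * jacobi_rho n a b t) has_integral 0) {-1..1}" by simp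
  moreover have "1 / c * jacobi_rho n a b t = jacobi_density a b t * jacobi_poly n a b t" for t
    using pos by (simp add: c_def jacobi_rho_def jacobi_density_def)
  ultimately show ?thesis
    by (simp add: jacobi_mean_def integral_unique)
qed

text \<open>Both products of binomials that meet at the same powers reduce to the same product by absorption; their
  factors add up to $n + 1 + a + b + 1$, which does not depend on the summation index.\<close>

lemma jacobi_poly_has_derivative:
  "(jacobi_poly (Suc n) a b has_real_derivative
     (real (Suc n) + a + b + 1) / 2 * jacobi_poly n (a + 1) (b + 1) t) (at t)"
proof -
  let ?u = "(t - 1) / 2" and ?v = "(t + 1) / 2"
  let ?A = "\<lambda>j. (real (Suc n) + a) gchoose j" and ?B = "\<lambda>j. (real (Suc n) + b) gchoose j"
  define U where "U j = ?A j * ?B (Suc n - j) * real (Suc n - j) * ?u ^ (n - j) * ?v ^ j" for j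
  define V where "V j = ?A j * ?B (Suc n - j) * real j * ?u ^ (Suc n - j) * ?v ^ (j - 1)" for j
  have "((\<lambda>t. c * d * ((t - 1) / 2) ^ k * ((t + 1) / 2) ^ l) has_real_derivative
      (c * d * real k * ?u ^ (k - 1) * ?v ^ l + c * d * real l * ?u ^ k * ?v ^ (l - 1)) / 2) (at t)"
    for c d :: real and k l
    by (auto intro!: derivative_eq_intros simp: algebra_simps add_divide_distrib)
  from this[of "?A j" "?B (Suc n - j)" "Suc n - j" j for j]
  have "((\<lambda>t. ?A j * ?B (Suc n - j) * ((t - 1) / 2) ^ (Suc n - j) * ((t + 1) / 2) ^ j)
      has_real_derivative (U j + V j) / 2) (at t)" for j
    by (simp add: U_def V_def)
  then have "(jacobi_poly (Suc n) a b has_real_derivative (\<Sum>j=0..Suc n. (U j + V j) / 2)) (at t)"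
    unfolding jacobi_poly_def[abs_def] by (intro DERIV_sum)
  also have "(\<Sum>j=0..Suc n. (U j + V j) / 2) = ((\<Sum>j\<le>Suc n. U j) + (\<Sum>j\<le>Suc n. V j)) / 2"
    by (simp add: sum_divide_distrib[symmetric] sum.distrib atLeast0AtMost)
  also have "(\<Sum>j\<le>Suc n. U j) = (\<Sum>j\<le>n. U j)"
    by (simp add: U_def)
  also have "(\<Sum>j\<le>Suc n. V j) = (\<Sum>j\<le>n. V (Suc j))"
    by (subst sum.atMost_Suc_shift) (simp add: V_def)
  also have "(\<Sum>j\<le>n. U j) + (\<Sum>j\<le>n. V (Suc j)) = (\<Sum>j\<le>n. (real (Suc n) + a + b + 1) *
      (?A j * ?B (n - j) * ?u ^ (n - j) * ?v ^ j))"
    unfolding sum.distrib[symmetric]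
  proof (intro sum.cong refl)
    fix j assume "j \<in> {..n}"
    then have j: "j \<le> n" and Sd: "Suc n - j = Suc (n - j)" by auto
    let ?T = "?A j * ?B (n - j) * ?u ^ (n - j) * ?v ^ j"
    have "real (Suc (n - j)) * ?B (Suc (n - j)) = (real (Suc n) + b - real (n - j)) * ?B (n - j)"
      by (metis gbinomial_absorb_comp gbinomial_absorption mult.commute of_nat_Suc)
    moreover have "U j = ?A j * (real (Suc (n - j)) * ?B (Suc (n - j))) * ?u ^ (n - j) * ?v ^ j"
      by (simp add: U_def Sd)
    ultimately have U: "U j = (real (Suc n) + b - real (n - j)) * ?T"
      by (simp only: mult_ac)
    have "real (Suc j) * ?A (Suc j) = (real (Suc n) + a - real j) * ?A j"
      by (metis gbinomial_absorb_comp gbinomial_absorption mult.commute of_nat_Suc)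
    moreover have "V (Suc j) = (real (Suc j) * ?A (Suc j)) * ?B (n - j) * ?u ^ (n - j) * ?v ^ j"
      by (simp add: V_def)
    ultimately have V: "V (Suc j) = (real (Suc n) + a - real j) * ?T"
      by (simp only: mult_ac)
    show "U j + V (Suc j) = (real (Suc n) + a + b + 1) * ?T"
      unfolding U V distrib_right[symmetric] using j by (simp add: of_nat_diff)
  qed
  also have "\<dots> / 2 = (real (Suc n) + a + b + 1) / 2 * jacobi_poly n (a + 1) (b + 1) t"
    by (simp add: jacobi_poly_def sum_distrib_left[symmetric] atLeast0AtMost add_ac)
  finally show ?thesis .
qed

text \<open>For Jacobi polynomials this is the analogue of Taylor's formula: derivatives at a point are replaced by
  means of derivatives, and the powers by normalised Jacobi polynomials. The normalisation is the one that lets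
  differentiation lower the index while raising both parameters by one, so the induction hypothesis
  applies to the derivative of $p$ with parameters $a + 1$ and $b + 1$.\<close>

lemma jacobi_expansion:
  assumes "a > -1" "b > -1" "degree p \<le> q"
  shows "(\<Sum>i\<le>q. 2 ^ i / pochhammer (a + b + 1 + real i) i * jacobi_poly i a b x *
      jacobi_mean (a + real i) (b + real i) (poly ((pderiv ^^ i) p))) = poly p x"
  using assms
proof (induction q arbitrary: a b p x)
  case 0
  then obtain c where "p = [:c:]" by (metis degree_eq_zeroE le_zero_eq)
  moreover have "poly [:c:] = (\<lambda>_. c)" by auto
  ultimately show ?case using 0 jacobi_mean_const[of a b c] by (simp add: jacobi_poly_def)
next
  case (Suc q)
  define k where "k i = 2 ^ i / pochhammer (a + b + 1 + real i) i" for i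
  define m where "m i = jacobi_mean (a + real i) (b + real i) (poly ((pderiv ^^ i) p))" for i
  define S where "S x = (\<Sum>i\<le>Suc q. k i * jacobi_poly i a b x * m i)" for x
  have S_alt: "S x = m 0 + (\<Sum>i\<le>q. k (Suc i) * jacobi_poly (Suc i) a b x * m (Suc i))" for x
    unfolding S_def by (subst sum.atMost_Suc_shift) (simp add: k_def jacobi_poly_def)
  have k_Suc: "k (Suc i) * ((real (Suc i) + a + b + 1) / 2) =
      2 ^ i / pochhammer (a + 1 + (b + 1) + 1 + real i) i" for i
  proof -
    have "pochhammer (a + b + 1 + real (Suc i)) (Suc i) =
        (real (Suc i) + a + b + 1) * pochhammer (a + 1 + (b + 1) + 1 + real i) i"
      by (simp add: pochhammer_rec add_ac)
    moreover have "real (Suc i) + a + b + 1 \<noteq> 0"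
      using Suc.prems by simp
    ultimately show ?thesis
      unfolding k_def by (simp del: of_nat_Suc)
  qed
  have "(S has_real_derivative poly (pderiv p) x) (at x)" for x
  proof -
    have "(S has_real_derivative (\<Sum>i\<le>q. k (Suc i) *
        ((real (Suc i) + a + b + 1) / 2 * jacobi_poly i (a + 1) (b + 1) x) * m (Suc i))) (at x)"
      unfolding S_alt[abs_def]
      by (auto intro!: derivative_eq_intros jacobi_poly_has_derivative sum.cong simp: mult_ac)
    also have "(\<Sum>i\<le>q. k (Suc i) *
        ((real (Suc i) + a + b + 1) / 2 * jacobi_poly i (a + 1) (b + 1) x) * m (Suc i)) =
      (\<Sum>i\<le>q. 2 ^ i / pochhammer (a + 1 + (b + 1) + 1 + real i) i * jacobi_poly i (a + 1) (b + 1) x *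
      jacobi_mean (a + 1 + real i) (b + 1 + real i) (poly ((pderiv ^^ i) (pderiv p))))"
      unfolding k_Suc[symmetric] m_def by (simp add: funpow_swap1 add_ac mult_ac)
    also have "\<dots> = poly (pderiv p) x"
      using Suc.prems by (intro Suc.IH) (auto simp: degree_pderiv)
    finally show ?thesis .
  qed
  then have "((\<lambda>x. poly p x - S x) has_real_derivative 0) (at x)" for x
    by (auto intro!: derivative_eq_intros)
  then obtain C where C: "poly p x - S x = C" for x
    using DERIV_isconst_all by blast
  \<comment> \<open>The two sides differ by the constant \<open>C\<close>; comparing their means shows that it is zero.\<close>
  have cont: "continuous_on {-1..1} (jacobi_poly i a b)" for i
    unfolding jacobi_poly_def[abs_def] by (intro continuous_intros) auto
  have "((\<lambda>t. jacobi_density a b t * m 0 + (\<Sum>i\<le>q. (k (Suc i) * m (Suc i)) *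
      (jacobi_density a b t * jacobi_poly (Suc i) a b t))) has_integral
      m 0 + (\<Sum>i\<le>q. (k (Suc i) * m (Suc i)) * 0)) {-1..1}"
  proof (intro has_integral_add has_integral_sum has_integral_mult_right)
    show "((\<lambda>t. jacobi_density a b t * m 0) has_integral m 0) {-1..1}"
      using has_integral_mult_left[OF jacobi_density_has_integral, of a b "m 0"] Suc.prems by simp
    show "((\<lambda>t. jacobi_density a b t * jacobi_poly (Suc i) a b t) has_integral 0) {-1..1}" for i
      using jacobi_mean_has_integral[OF _ _ cont, of a b "Suc i"] jacobi_mean_jacobi_poly[of a b "Suc i"] Suc.prems by simp
  qed auto
  then have "((\<lambda>t. jacobi_density a b t * S t) has_integral m 0) {-1..1}"
    by (simp add: S_alt sum_distrib_left distrib_left mult_ac)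
  moreover have "((\<lambda>t. jacobi_density a b t * poly p t) has_integral m 0) {-1..1}"
    using jacobi_mean_has_integral[of a b "poly p"] Suc.prems by (simp add: m_def continuous_on_poly)
  ultimately have "((\<lambda>t. jacobi_density a b t * poly p t - jacobi_density a b t * S t) has_integral m 0 - m 0) {-1..1}"
    by (rule has_integral_diff[rotated])
  then have "((\<lambda>t. jacobi_density a b t * C) has_integral 0) {-1..1}"
    by (simp add: right_diff_distrib[symmetric] C)
  moreover have "((\<lambda>t. jacobi_density a b t * C) has_integral C) {-1..1}"
    using has_integral_mult_left[OF jacobi_density_has_integral, of a b C] Suc.prems by simp
  ultimately have "C = 0" using has_integral_unique by blast
  then show ?case using C[of x] by (simp add: S_def k_def m_def del: sum.atMost_Suc)
qed

section \<open>Exactness of the kernel Q on polynomials\<close>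

text \<open>The fraction next to \<open>Q_coeff\<close> is the inverse of the factor in \<open>jacobi_mean_higher_pderiv\<close>, with
  $a + n$ and $b + n$ for $a$ and $b$ and $i$ for $n$; the right-hand side is the coefficient in
  \<open>jacobi_expansion\<close>.\<close>

lemma Q_coeff_pochhammer:
  assumes "a > -1" "b > -1"
  shows "Q_coeff a b n i * (2 ^ i / pochhammer (a + real n + (b + real n) + real i + 2) i) =
    2 ^ i / pochhammer (a + real n + (b + real n) + 1 + real i) i"
proof (cases "i = 0")
  case False
  define z where "z = a + b + 2 * real n + 1 + real i"
  have z: "z > 0" using assms False by (simp add: z_def)
  have eq: "z * pochhammer (z + 1) i = pochhammer z i * (z + real i)"
    by (metis pochhammer_rec pochhammer_Suc)
  have "Q_coeff a b n i = (z + real i) / z"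
    using False by (simp add: Q_coeff_def z_def algebra_simps)
  moreover have "(z + real i) / z * (2 ^ i / pochhammer (z + 1) i) = 2 ^ i / pochhammer z i"
  proof -
    have "pochhammer (z + 1) i = pochhammer z i * (z + real i) / z"
      using z eq by (simp add: nonzero_eq_divide_eq mult.commute)
    moreover have "z + real i > 0" using z by simp
    ultimately show ?thesis using z by simp
  qed
  moreover have "a + real n + (b + real n) + real i + 2 = z + 1"
    "a + real n + (b + real n) + 1 + real i = z"
    by (simp_all add: z_def)
  ultimately show ?thesis by (simp only:)
qed (simp add: Q_coeff_def)

text \<open>The $n$-th derivative comes from $\rho$, and the value at $0$ from the expansion of
  that derivative, which has degree at most $q$.\<close>

lemma Q_kernel_has_integral:
  assumes "\<alpha> > -1" "\<beta> > -1" "degree p \<le> n + q"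
  shows "((\<lambda>t. Q_kernel \<alpha> \<beta> n q t * poly p t) has_integral poly ((pderiv ^^ n) p) 0) {-1..1}"
proof -
  define a b g where "a = \<alpha> + real n" and "b = \<beta> + real n" and "g = (pderiv ^^ n) p"
  have ab: "a > -1" "b > -1" using assms by (auto simp: a_def b_def)
  let ?m = "\<lambda>i j. jacobi_mean (\<alpha> + real i - real j + real n) (\<beta> + real j + real n) (poly g)"
  have inner: "(\<Sum>j\<le>i. (-1) ^ (i + j) * real (i choose j) * Q_coeff \<alpha> \<beta> n i * ?m i j) =
      2 ^ i / pochhammer (a + b + 1 + real i) i *
        jacobi_mean (a + real i) (b + real i) (poly ((pderiv ^^ i) g))" for i
  proof -
    have "(\<Sum>j\<le>i. (-1) ^ (i + j) * real (i choose j) * Q_coeff \<alpha> \<beta> n i * ?m i j) =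
      Q_coeff \<alpha> \<beta> n i * (\<Sum>j\<le>i. (-1) ^ (i + j) * real (i choose j) *
        jacobi_mean (a + real i - real j) (b + real j) (poly g))"
      unfolding sum_distrib_left a_def b_def
    proof (intro sum.cong refl)
      fix j
      have "?m i j = jacobi_mean (\<alpha> + real n + real i - real j) (\<beta> + real n + real j) (poly g)"
        by (intro arg_cong2[of _ _ _ _ "\<lambda>u v. jacobi_mean u v (poly g)"]) auto
      then show "(-1) ^ (i + j) * real (i choose j) * Q_coeff \<alpha> \<beta> n i * ?m i j =
          Q_coeff \<alpha> \<beta> n i * ((-1) ^ (i + j) * real (i choose j) *
            jacobi_mean (\<alpha> + real n + real i - real j) (\<beta> + real n + real j) (poly g))"
        by simp
    qed
    moreover have "pochhammer (a + b + real i + 2) i \<noteq> 0"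
      using pochhammer_pos[of "a + b + real i + 2" i] ab by simp
    ultimately show ?thesis
      unfolding jacobi_mean_higher_pderiv[OF ab]
        Q_coeff_pochhammer[OF assms(1,2), of n i, folded a_def b_def, symmetric]
      by simp
  qed
  have "((\<lambda>t. \<Sum>i\<le>q. jacobi_poly i a b 0 * (\<Sum>j\<le>i. (-1) ^ (i + j) * real (i choose j) *
      Q_coeff \<alpha> \<beta> n i * (jacobi_rho n (\<alpha> + real i - real j) (\<beta> + real j) t * poly p t)))
    has_integral (\<Sum>i\<le>q. jacobi_poly i a b 0 * (\<Sum>j\<le>i. (-1) ^ (i + j) * real (i choose j) *
      Q_coeff \<alpha> \<beta> n i * ?m i j))) {-1..1}"
    unfolding g_def
    by (intro has_integral_sum has_integral_mult_right jacobi_rho_has_integral)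
       (use assms in auto)
  moreover have "(\<Sum>i\<le>q. jacobi_poly i a b 0 * (\<Sum>j\<le>i. (-1) ^ (i + j) * real (i choose j) *
      Q_coeff \<alpha> \<beta> n i * ?m i j)) = poly g 0"
    unfolding inner using jacobi_expansion[OF ab, of g q 0] assms(3)
    by (simp add: g_def degree_higher_pderiv mult_ac)
  ultimately show ?thesis
    by (simp add: Q_kernel_def a_def b_def g_def sum_distrib_right atLeast0AtMost mult.assoc)
qed

lemma Q_kernel_absolutely_integrable:
  assumes "\<alpha> > -1" "\<beta> > -1"
  shows "Q_kernel \<alpha> \<beta> n q absolutely_integrable_on {-1..1}"
  unfolding Q_kernel_def[abs_def]
  by (intro absolutely_integrable_sum set_integrable_mult_right jacobi_rho_absolutely_integrable)
     (use assms in auto)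

text \<open>If such a moment vanished, $Q$ would be zero almost everywhere, and so would be its integral
  against $t^n$. But that integral is $n!$.\<close>

lemma Q_kernel_abs_moment_pos:
  assumes "\<alpha> > -1" "\<beta> > -1"
  shows "0 < (LINT t:{-1..1}|lebesgue. \<bar>t ^ k * Q_kernel \<alpha> \<beta> n q t\<bar>)"
proof -
  let ?Q = "Q_kernel \<alpha> \<beta> n q"
  let ?f = "\<lambda>t. indicator {-1..1} t * \<bar>t ^ k * ?Q t\<bar>"
  have prod: "(\<lambda>t. ?Q t * t ^ m) absolutely_integrable_on {-1..1}" for m
    by (intro absolutely_integrable_mult_continuous Q_kernel_absolutely_integrable assms continuous_intros)
  have "integrable lebesgue ?f"
    using set_integrable_abs[OF prod[of k]]
    by (simp add: set_integrable_def mult.commute)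
  then have zero: "(LINT t|lebesgue. ?f t) = 0 \<longleftrightarrow> (AE t in lebesgue. ?f t = 0)"
    by (intro integral_nonneg_eq_0_iff_AE) auto
  have "(LINT t|lebesgue. ?f t) \<noteq> 0"
  proof
    assume "(LINT t|lebesgue. ?f t) = 0"
    with zero have "AE t in lebesgue. ?f t = 0" by simp
    moreover have "AE t::real in lebesgue. t \<noteq> 0"
      by (intro AE_completion AE_lborel_singleton)
    ultimately have "AE t in lebesgue. indicator {-1..1} t *\<^sub>R (?Q t * t ^ n) = 0"
      by eventually_elim auto
    then have "(LINT t:{-1..1}|lebesgue. ?Q t * t ^ n) = 0"
      unfolding set_lebesgue_integral_def by (rule integral_eq_zero_AE)
    moreover have "(LINT t:{-1..1}|lebesgue. ?Q t * t ^ n) = fact n"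
      using Q_kernel_has_integral[OF assms, of "monom 1 n" n q]
      by (simp add: set_lebesgue_integral_eq_integral(2)[OF prod] poly_monom degree_monom_eq
          integral_unique poly_0_coeff_0 coeff_higher_pderiv pochhammer_fact[symmetric])
    ultimately show False by simp
  qed
  moreover have "(LINT t|lebesgue. ?f t) \<ge> 0"
    by (intro integral_nonneg_AE) auto
  ultimately have "(LINT t|lebesgue. ?f t) > 0"
    by linarith
  then show ?thesis
    by (simp add: set_lebesgue_integral_def)
qed

section \<open>The error of the estimator\<close>

lemma Taylor_remainder_bound:
  assumes "open I" "is_interval I" "Ck_on N f I" "N > 0"
    and bound: "\<forall>x\<in>I. \<bar>(deriv ^^ N) f x\<bar> \<le> M" and "x \<in> I" "y \<in> I"
  shows "\<bar>f y - (\<Sum>k<N. (deriv ^^ k) f x / fact k * (y - x) ^ k)\<bar> \<le> M / fact N * \<bar>y - x\<bar> ^ N"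
proof (cases "y = x")
  case True
  have "(\<Sum>k<N. (deriv ^^ k) f x / fact k * (y - x) ^ k) = f x"
    using \<open>N > 0\<close> True by (cases N) (simp_all add: sum.lessThan_Suc_shift del: sum.lessThan_Suc)
  then show ?thesis using True \<open>N > 0\<close> by (simp add: zero_power)
next
  case False
  have sub: "t \<in> I" if "min x y \<le> t" "t \<le> max x y" for t
    using assms(2,6,7) that unfolding is_interval_1 by (metis max_def min_def)
  have "DERIV ((deriv ^^ m) f) t :> (deriv ^^ Suc m) f t" if "m < N" "t \<in> I" for m t
    using assms(1,3) that
    by (simp add: Ck_on_def DERIV_deriv_iff_real_differentiable differentiable_on_eq_differentiable_at)
  with sub obtain t where t: "if y < x then y < t \<and> t < x else x < t \<and> t < y"
    and eq: "f y = (\<Sum>m<N. (deriv ^^ m) f x / fact m * (y - x) ^ m) + (deriv ^^ N) f t / fact N * (y - x) ^ N"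
    using Taylor[of N "\<lambda>m. (deriv ^^ m) f" f "min x y" "max x y" x y] \<open>N > 0\<close> False by auto
  have "t \<in> I" using t by (intro sub) (auto split: if_splits)
  then show ?thesis
    using bound by (simp add: eq abs_mult power_abs divide_right_mono mult_right_mono)
qed

text \<open>Subtracting the integral of $Q$ against the Taylor polynomial $p$ of $t \mapsto f(x + ht)$ removes exactly
  $h^n f^{(n)}(x)$. What is left is the integral of $Q$ against remainder plus noise, which is
  estimated pointwise.\<close>

lemma estimator_error_bound:
  assumes "open I" "is_interval I" "\<alpha> > -1" "\<beta> > -1" "Ck_on (n + 1 + q) f I"
    and bound: "\<forall>x\<in>I. \<bar>(deriv ^^ (n + 1 + q)) f x\<bar> \<le> M"
    and noise: "noise_on I \<omega>" and "h > 0" and x: "x \<in> inner_part I h"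
  shows "\<bar>deriv_estimator n h \<alpha> \<beta> q (\<lambda>y. f y + \<omega> y) x - (deriv ^^ n) f x\<bar>
    \<le> C2 M \<alpha> \<beta> n q * h ^ (q + 1) + C3 \<alpha> \<beta> n q * (noise_level I \<omega> / h ^ n)"
proof -
  define N where "N = n + 1 + q"
  have "N > 0" by (simp add: N_def)
  define \<delta> where "\<delta> = noise_level I \<omega>"
  let ?Q = "Q_kernel \<alpha> \<beta> n q"
  define p where "p = (\<Sum>k<N. monom ((deriv ^^ k) f x / fact k * h ^ k) k)"
  define g where "g t = f (x + h * t) + \<omega> (x + h * t)" for t
  have xI: "x \<in> I" and "{x - h..x + h} \<subseteq> I" using x by (auto simp: inner_part_def)
  moreover have iff: "x + h * t \<in> {x - h..x + h} \<longleftrightarrow> t \<in> {-1..1}" for t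
    using \<open>h > 0\<close> mult_le_cancel_left_pos[of h t 1] mult_le_cancel_left_pos[of h "-1" t] by auto
  ultimately have yI: "x + h * t \<in> I" if "t \<in> {-1..1}" for t
    using that by blast
  have poly_p: "poly p t = (\<Sum>k<N. (deriv ^^ k) f x / fact k * (x + h * t - x) ^ k)" for t
    by (simp add: p_def poly_sum poly_monom power_mult_distrib mult.assoc)
  have rem: "\<bar>f (x + h * t) - poly p t\<bar> \<le> M / fact N * h ^ N * \<bar>t\<bar> ^ N" if "t \<in> {-1..1}" for t
    using Taylor_remainder_bound[OF assms(1,2) assms(5)[folded N_def] _ bound[folded N_def] xI yI[OF that]]
      \<open>h > 0\<close> \<open>N > 0\<close> by (simp add: poly_p abs_mult power_mult_distrib mult_ac)
  have \<omega>_le: "\<bar>\<omega> y\<bar> \<le> \<delta>" if "y \<in> I" for y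
  proof -
    obtain B where "\<And>y. y \<in> I \<Longrightarrow> \<bar>\<omega> y\<bar> \<le> B"
      using noise by (auto simp: noise_on_def bounded_iff)
    then show ?thesis
      unfolding \<delta>_def noise_level_def using that by (intro cSUP_upper bdd_aboveI2)
  qed
  have f_cont: "continuous_on I f"
  proof (rule differentiable_imp_continuous_on)
    show "f differentiable_on I" using assms(5) by (force simp: Ck_on_def)
  qed
  have fh_cont: "continuous_on {-1..1} (\<lambda>t. f (x + h * t))"
    by (rule continuous_on_compose2[OF f_cont]) (auto intro!: continuous_intros yI)
  \<comment> \<open>A product of integrable functions need not be integrable. The noise times \<open>Q\<close> is, because the noise
  is bounded; its integrability along the affine path supplies the measurability.\<close>
  have "\<omega> absolutely_integrable_on {x - h..x + h}"
    using noise \<open>{x - h..x + h} \<subseteq> I\<close> by (auto simp: noise_on_def intro: set_integrable_subset)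
  then have "integrable lebesgue (\<lambda>t. indicator {x - h..x + h} (x + h * t) *\<^sub>R \<omega> (x + h * t))"
    unfolding set_integrable_def using \<open>h > 0\<close> by (intro lebesgue_integrable_real_affine) auto
  also have "(\<lambda>t. indicator {x - h..x + h} (x + h * t) *\<^sub>R \<omega> (x + h * t)) =
      (\<lambda>t. indicator {-1..1} t *\<^sub>R \<omega> (x + h * t))"
    using iff by (auto simp: indicator_def fun_eq_iff)
  finally have \<omega>_int: "(\<lambda>t. \<omega> (x + h * t)) absolutely_integrable_on {-1..1}"
    by (simp add: set_integrable_def)
  have Q_int: "?Q absolutely_integrable_on {-1..1}"
    by (rule Q_kernel_absolutely_integrable[OF assms(3,4)])
  have "bounded ((\<lambda>t. \<omega> (x + h * t)) ` {-1..1})"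
    using \<omega>_le yI by (intro boundedI[of _ \<delta>]) auto
  then have "(\<lambda>t. \<omega> (x + h * t) * ?Q t) absolutely_integrable_on {-1..1}"
    using \<omega>_int Q_int
    by (intro absolutely_integrable_bounded_measurable_product_real)
       (auto dest: absolutely_integrable_measurable[THEN iffD1, rotated])
  then have Q\<omega>: "(\<lambda>t. ?Q t * \<omega> (x + h * t)) absolutely_integrable_on {-1..1}"
    by (simp add: mult.commute)
  have Qc: "(\<lambda>t. ?Q t * u t) absolutely_integrable_on {-1..1}" if "continuous_on {-1..1} u" for u
    by (rule absolutely_integrable_mult_continuous[OF Q_int that])
  have Qg: "(\<lambda>t. ?Q t * g t) absolutely_integrable_on {-1..1}"
    unfolding g_def distrib_left by (intro set_integral_add Qc fh_cont Q\<omega>)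
  have Qp: "(\<lambda>t. ?Q t * poly p t) absolutely_integrable_on {-1..1}"
    by (intro Qc continuous_intros)

  have "degree p \<le> n + q"
    unfolding p_def by (intro degree_sum_le) (auto intro: order_trans[OF degree_monom_le] simp: N_def)
  from Q_kernel_has_integral[OF assms(3,4) this]
  have "(LINT t:{-1..1}|lebesgue. ?Q t * poly p t) = poly ((pderiv ^^ n) p) 0"
    by (simp add: set_lebesgue_integral_eq_integral(2)[OF Qp] integral_unique)
  also have "\<dots> = h ^ n * (deriv ^^ n) f x"
    by (simp add: poly_0_coeff_0 coeff_higher_pderiv p_def coeff_sum N_def pochhammer_fact[symmetric])
  finally have exact: "(LINT t:{-1..1}|lebesgue. ?Q t * poly p t) = h ^ n * (deriv ^^ n) f x" .

  let ?E = "\<lambda>t. M / fact N * h ^ N * \<bar>t ^ N * ?Q t\<bar> + \<delta> * \<bar>?Q t\<bar>"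
  have E1: "(\<lambda>t. M / fact N * h ^ N * \<bar>t ^ N * ?Q t\<bar>) absolutely_integrable_on {-1..1}"
    unfolding mult.commute[of "_ ^ N" "?Q _"]
    by (intro set_integrable_mult_right set_integrable_abs Qc continuous_intros)
  have E2: "(\<lambda>t. \<delta> * \<bar>?Q t\<bar>) absolutely_integrable_on {-1..1}"
    by (intro set_integrable_mult_right set_integrable_abs Q_int)
  have "deriv_estimator n h \<alpha> \<beta> q (\<lambda>y. f y + \<omega> y) x - (deriv ^^ n) f x =
      1 / h ^ n * ((LINT t:{-1..1}|lebesgue. ?Q t * g t) - (LINT t:{-1..1}|lebesgue. ?Q t * poly p t))"
    using \<open>h > 0\<close> by (simp add: deriv_estimator_def exact g_def right_diff_distrib)
  also have "\<dots> = 1 / h ^ n * (LINT t:{-1..1}|lebesgue. ?Q t * g t - ?Q t * poly p t)"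
    by (simp add: set_integral_diff[OF Qg Qp])
  finally have error: "\<bar>deriv_estimator n h \<alpha> \<beta> q (\<lambda>y. f y + \<omega> y) x - (deriv ^^ n) f x\<bar> =
      1 / h ^ n * \<bar>LINT t:{-1..1}|lebesgue. ?Q t * g t - ?Q t * poly p t\<bar>"
    using \<open>h > 0\<close> by (simp add: abs_mult)
  have "\<bar>LINT t:{-1..1}|lebesgue. ?Q t * g t - ?Q t * poly p t\<bar> \<le>
      (LINT t:{-1..1}|lebesgue. \<bar>?Q t * g t - ?Q t * poly p t\<bar>)"
    using set_integral_norm_bound[OF set_integral_diff(1)[OF Qg Qp]] by simp
  also have "\<dots> \<le> (LINT t:{-1..1}|lebesgue. ?E t)"
  proof (rule set_integral_mono)
    show "(\<lambda>t. \<bar>?Q t * g t - ?Q t * poly p t\<bar>) absolutely_integrable_on {-1..1}"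
      by (intro set_integrable_abs set_integral_diff Qg Qp)
    show "?E absolutely_integrable_on {-1..1}"
      by (rule set_integral_add(1)[OF E1 E2])
    fix t :: real assume t: "t \<in> {-1..1}"
    have "\<bar>g t - poly p t\<bar> \<le> \<bar>f (x + h * t) - poly p t\<bar> + \<bar>\<omega> (x + h * t)\<bar>"
      unfolding g_def by linarith
    also have "\<dots> \<le> M / fact N * h ^ N * \<bar>t\<bar> ^ N + \<delta>"
      by (intro add_mono rem \<omega>_le yI t)
    finally have "\<bar>?Q t\<bar> * \<bar>g t - poly p t\<bar> \<le> \<bar>?Q t\<bar> * (M / fact N * h ^ N * \<bar>t\<bar> ^ N + \<delta>)"
      by (rule mult_left_mono) simp
    moreover have "\<bar>?Q t * g t - ?Q t * poly p t\<bar> = \<bar>?Q t\<bar> * \<bar>g t - poly p t\<bar>"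
      by (simp add: right_diff_distrib[symmetric] abs_mult)
    moreover have "?E t = \<bar>?Q t\<bar> * (M / fact N * h ^ N * \<bar>t\<bar> ^ N + \<delta>)"
      by (simp add: abs_mult power_abs distrib_left)
    ultimately show "\<bar>?Q t * g t - ?Q t * poly p t\<bar> \<le> ?E t"
      by (simp only:)
  qed
  also have "(LINT t:{-1..1}|lebesgue. ?E t) =
      M / fact N * h ^ N * (LINT t:{-1..1}|lebesgue. \<bar>t ^ N * ?Q t\<bar>) + \<delta> * C3 \<alpha> \<beta> n q"
    using set_integral_add(2)[OF E1 E2] by (simp add: C3_def)
  also have "M / fact N * h ^ N * (LINT t:{-1..1}|lebesgue. \<bar>t ^ N * ?Q t\<bar>) = C2 M \<alpha> \<beta> n q * h ^ N"
    by (simp add: C2_def N_def)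
  finally have "\<bar>deriv_estimator n h \<alpha> \<beta> q (\<lambda>y. f y + \<omega> y) x - (deriv ^^ n) f x\<bar> \<le>
      1 / h ^ n * (C2 M \<alpha> \<beta> n q * h ^ N + \<delta> * C3 \<alpha> \<beta> n q)"
    unfolding error using \<open>h > 0\<close> by (intro mult_left_mono) auto
  also have "\<dots> =
      C2 M \<alpha> \<beta> n q * h ^ (q + 1) + C3 \<alpha> \<beta> n q * (\<delta> / h ^ n)"
    using \<open>h > 0\<close> by (simp add: N_def power_add field_simps)
  finally show ?thesis
    by (simp only: \<delta>_def)
qed

section \<open>The balanced step size\<close>

text \<open>With $h$ proportional to $\delta^{1/(n+q+1)}$ the truncation term $h^{q+1}$ and the noise term
  $\delta / h^n$ scale alike in $\delta$.\<close>

lemma balanced_step_size: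
  fixes c \<delta> :: real and n q :: nat
  assumes "c > 0" "\<delta> > 0"
  defines "r \<equiv> real n + real q + 1"
  defines "h \<equiv> (c * \<delta>) powr (1 / r)"
  shows "h ^ (q + 1) = c powr ((real q + 1) / r) * \<delta> powr ((real q + 1) / r)"
    and "\<delta> / h ^ n = c powr (- (real n / r)) * \<delta> powr ((real q + 1) / r)"
proof -
  have pos: "h > 0" using assms by (simp add: h_def)
  have hk: "h ^ k = c powr (real k / r) * \<delta> powr (real k / r)" for k
  proof -
    have "h ^ k = h powr real k" using pos by (simp add: powr_realpow)
    also have "\<dots> = (c * \<delta>) powr (real k / r)" by (simp add: h_def powr_powr)
    finally show ?thesis using assms(1,2) by (simp add: powr_mult)
  qed
  show "h ^ (q + 1) = c powr ((real q + 1) / r) * \<delta> powr ((real q + 1) / r)"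
    using hk[of "q + 1"] by (simp add: add.commute)
  have "(real q + 1) / r = 1 - real n / r"
    by (simp add: r_def field_simps)
  then have "\<delta> powr ((real q + 1) / r) = \<delta> / \<delta> powr (real n / r)"
    using assms(2) by (simp only: powr_diff powr_one)
  then show "\<delta> / h ^ n = c powr (- (real n / r)) * \<delta> powr ((real q + 1) / r)"
    by (simp add: hk powr_minus divide_inverse)
qed

theorem proposition12:
  fixes I :: "real set" and n q :: nat and \<alpha> \<beta> M :: real and f :: "real \<Rightarrow> real"
  assumes "open I" and "is_interval I" and "I \<noteq> {}"
    and "\<alpha> > -1" and "\<beta> > -1"
    and "Ck_on (n + 1 + q) f I"
    and "M > 0" and "\<forall>x\<in>I. \<bar>(deriv ^^ (n + 1 + q)) f x\<bar> \<le> M"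
  shows "(\<forall>\<omega> \<delta> h. noise_on I \<omega> \<longrightarrow> \<delta> = noise_level I \<omega> \<longrightarrow> h > 0 \<longrightarrow>
            sup_norm_on (inner_part I h)
              (\<lambda>x. deriv_estimator n h \<alpha> \<beta> q (\<lambda>y. f y + \<omega> y) x - (deriv ^^ n) f x)
            \<le> ennreal (C2 M \<alpha> \<beta> n q * h ^ (q + 1) + C3 \<alpha> \<beta> n q * (\<delta> / h ^ n)))
       \<and> (n \<ge> 1 \<longrightarrow>
           (\<exists>K. \<forall>\<^sub>F \<delta> in at_right 0. \<forall>\<omega> h.
              noise_on I \<omega> \<longrightarrow> \<delta> = noise_level I \<omega> \<longrightarrow> h = h_choice M \<alpha> \<beta> n q \<delta> \<longrightarrow>
              sup_norm_on (inner_part I h)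
                (\<lambda>x. deriv_estimator n h \<alpha> \<beta> q (\<lambda>y. f y + \<omega> y) x - (deriv ^^ n) f x)
              \<le> ennreal (K * \<delta> powr ((real q + 1) / (real n + 1 + real q)))))"
proof -
  let ?C2 = "C2 M \<alpha> \<beta> n q" and ?C3 = "C3 \<alpha> \<beta> n q"
  have error: "sup_norm_on (inner_part I h)
      (\<lambda>x. deriv_estimator n h \<alpha> \<beta> q (\<lambda>y. f y + \<omega> y) x - (deriv ^^ n) f x)
      \<le> ennreal (?C2 * h ^ (q + 1) + ?C3 * (noise_level I \<omega> / h ^ n))"
    if "noise_on I \<omega>" "h > 0" for \<omega> h
    unfolding sup_norm_on_def
    by (intro SUP_least ennreal_leI estimator_error_bound[OF assms(1,2,4,5,6,8) that])
  have "?C2 > 0" "?C3 > 0"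
    using Q_kernel_abs_moment_pos[OF assms(4,5), of "n + 1 + q" n q]
      Q_kernel_abs_moment_pos[OF assms(4,5), of 0 n q] \<open>M > 0\<close>
    by (simp_all add: C2_def C3_def)
  have rate: "\<exists>K. \<forall>\<^sub>F \<delta> in at_right 0. \<forall>\<omega> h.
      noise_on I \<omega> \<longrightarrow> \<delta> = noise_level I \<omega> \<longrightarrow> h = h_choice M \<alpha> \<beta> n q \<delta> \<longrightarrow>
      sup_norm_on (inner_part I h)
        (\<lambda>x. deriv_estimator n h \<alpha> \<beta> q (\<lambda>y. f y + \<omega> y) x - (deriv ^^ n) f x)
      \<le> ennreal (K * \<delta> powr ((real q + 1) / (real n + 1 + real q)))" if "n \<ge> 1"
  proof -
    define r where "r = real n + real q + 1"
    define c where "c = real n * ?C3 / ((real q + 1) * ?C2)"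
    define K where "K = ?C2 * c powr ((real q + 1) / r) + ?C3 * c powr (- (real n / r))"
    have "c > 0" using \<open>?C2 > 0\<close> \<open>?C3 > 0\<close> that by (simp add: c_def)
    have "sup_norm_on (inner_part I h)
        (\<lambda>x. deriv_estimator n h \<alpha> \<beta> q (\<lambda>y. f y + \<omega> y) x - (deriv ^^ n) f x)
      \<le> ennreal (K * \<delta> powr ((real q + 1) / (real n + 1 + real q)))"
      if "\<delta> > 0" "noise_on I \<omega>" "\<delta> = noise_level I \<omega>" "h = h_choice M \<alpha> \<beta> n q \<delta>" for \<delta> \<omega> h
    proof -
      have h: "h = (c * \<delta>) powr (1 / r)"
        using that by (simp add: h_choice_def c_def r_def)
      then have "h > 0" using \<open>c > 0\<close> \<open>\<delta> > 0\<close> by simp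
      have "?C2 * h ^ (q + 1) + ?C3 * (\<delta> / h ^ n) = K * \<delta> powr ((real q + 1) / r)"
        using balanced_step_size[OF \<open>c > 0\<close> \<open>\<delta> > 0\<close>, where n = n and q = q, folded r_def, folded h]
        by (simp only: K_def distrib_right mult.assoc)
      moreover have "r = real n + 1 + real q" by (simp add: r_def)
      ultimately show ?thesis
        using error[OF that(2) \<open>h > 0\<close>] that(3) by simp
    qed
    then show ?thesis
      by (intro exI[of _ K] eventually_mono[OF eventually_at_right_less[of 0]]) blast
  qed
  show ?thesis using error rate by blast
qed

end
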